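(* Let $H$ be a complex Hilbert space and let $(v_n)_{n=1}^\infty$ be a total sequence in $H$, i.e., a sequence of vectors of $H$ whose linear span is dense in $H$. Then there are sequences $(w_n)_{n=1}^\infty$ and $(z_n)_{n=1}^\infty$ in $H$ such that for every $n\ge 1$ one has $z_n\in\operatorname{span}\{v_k : k\geq n/2\}$, and $$\mathrm{id}_H=\sum_{n=1}^\infty w_nz_n^*$$ with convergence in the strong operator topology (that is, for every $x\in H$, the partial sums $\sum_{n=1}^N (z_n^*x)\,w_n$ converge in norm to $x$ as $N\to\infty$). In particular, there is a sequence $(\lambda_n)_{n=1}^\infty$ of positive real numbers such that $(\lambda_n^{1/2}v_n)_{n=1}^\infty$ satisfies the lower frame inequality: $$\|x\|^2\le\sum_{n=1}^\infty\lambda_n|v_n^*x|^2\quad\text{for every }x\in H,$$ where the right-hand side is possibly $\infty$.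
   Context: A vector $v\in H$ is viewed as a "column vector", i.e., as the operator $\mathbb{C}\to H$, $c\mapsto cv$. Thus for $v,w\in H$, $v^*w\in\mathbb{C}$ is the inner product of $v$ and $w$ (conjugate-linear in $v$, linear in $w$), and $vw^*$ is the operator on $H$ of rank at most $1$ given by $x\mapsto (w^*x)\,v$. The symbol $\operatorname{span}$ denotes the (algebraic) linear span, i.e., the set of finite linear combinations, without closure; the index $k$ ranges over positive integers. $\mathrm{id}_H$ is the identity operator on $H$. *)

theory Defs
  imports "HOL-Analysis.Analysis"
begin

text \<open>
  A complex Hilbert space, as a type class. It extends \<^class>\<open>banach\<close>, so the space is complete
  for its norm; the norm is the one given by the inner product, and the real scalar multiplication
  is the restriction of the complex one. The inner product is conjugate-linear in the first and
  linear in the second argument, so that \<open>cinner v w\<close> is $v^* w$.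
\<close>

class chilbert_space = banach +
  fixes scaleC :: "complex \<Rightarrow> 'a \<Rightarrow> 'a"  (infixr "*\<^sub>C" 75)
    and cinner :: "'a \<Rightarrow> 'a \<Rightarrow> complex"
  assumes scaleC_add_right: "a *\<^sub>C (x + y) = a *\<^sub>C x + a *\<^sub>C y"
    and scaleC_add_left: "(a + b) *\<^sub>C x = a *\<^sub>C x + b *\<^sub>C x"
    and scaleC_scaleC: "a *\<^sub>C (b *\<^sub>C x) = (a * b) *\<^sub>C x"
    and scaleC_one: "1 *\<^sub>C x = x"
    and scaleR_scaleC: "r *\<^sub>R x = complex_of_real r *\<^sub>C x"
    and cinner_commute: "cinner x y = cnj (cinner y x)"
    and cinner_add_right: "cinner x (y + z) = cinner x y + cinner x z"
    and cinner_scaleC_right: "cinner x (a *\<^sub>C y) = a * cinner x y"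
    and cinner_ge_zero: "0 \<le> Re (cinner x x)"
    and cinner_eq_zero_iff: "cinner x x = 0 \<longleftrightarrow> x = 0"
    and norm_eq_sqrt_cinner: "norm x = sqrt (Re (cinner x x))"

instantiation complex :: chilbert_space
begin

definition scaleC_complex :: "complex \<Rightarrow> complex \<Rightarrow> complex"
  where "scaleC_complex a x = a * x"

definition cinner_complex :: "complex \<Rightarrow> complex \<Rightarrow> complex"
  where "cinner_complex x y = cnj x * y"

instance
proof
  fix x :: complex
  show "norm x = sqrt (Re (cinner x x))"
    by (simp add: cinner_complex_def cmod_def power2_eq_square)
qed (auto simp: scaleC_complex_def cinner_complex_def algebra_simps scaleR_conv_of_real)

end

global_interpretation complex_vector: vector_space "scaleC :: complex \<Rightarrow> 'a \<Rightarrow> 'a::chilbert_space"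
  by unfold_locales (rule scaleC_add_right scaleC_add_left scaleC_scaleC scaleC_one)+

abbreviation cspan :: "'a::chilbert_space set \<Rightarrow> 'a set"
  where "cspan \<equiv> complex_vector.span"

text \<open>Sequences are indexed by the positive integers; the value at \<open>0\<close> is never used.\<close>

definition total_sequence :: "(nat \<Rightarrow> 'a::chilbert_space) \<Rightarrow> bool"
  where "total_sequence v \<longleftrightarrow> closure (cspan {v n | n. 1 \<le> n}) = UNIV"

text \<open>The operator $v w^*$.\<close>

definition outer :: "'a::chilbert_space \<Rightarrow> 'a \<Rightarrow> 'a \<Rightarrow> 'a"
  where "outer v w = (\<lambda>x. cinner w x *\<^sub>C v)"

text \<open>\<open>sot_sums A T\<close>: the series $\sum_{n\ge 1} A_n$ converges to $T$ in the strong operator topology.\<close>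

definition sot_sums :: "(nat \<Rightarrow> 'a::chilbert_space \<Rightarrow> 'a) \<Rightarrow> ('a \<Rightarrow> 'a) \<Rightarrow> bool"
  where "sot_sums A T \<longleftrightarrow> (\<forall>x. (\<lambda>N. \<Sum>n=1..N. A n x) \<longlonglongrightarrow> T x)"

end

theory Submission imports Defs begin

text \<open>
  Let $V_m$ be the closed span of the $v_k$ with $k \ge m$. The space $V_{m+1}$ has codimension at
  most one in $V_m$; let $f_m \in V_m$ be a unit vector orthogonal to $V_{m+1}$, or zero if there is
  none. The $f_m$ span the orthogonal complement of $L = \bigcap_m V_m$. Interlacing them with an
  orthonormal basis $(g_m)$ of $L$ gives an orthonormal basis $b$ of the whole space, with $b_n = f_m$
  or $b_n = g_m$ for $m = \lceil n/2 \rceil$ according to the parity of $n$, such that $b_n$ is a limit of elements of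
  $\mathrm{span}\{v_k : k \ge n/2\}$. Choose $z_n$ in this span
  with $\|b_n - z_n\| \le 2^{-n-1}$. Then $A = \sum_n b_n z_n^*$ satisfies
  $\|\mathrm{id} - A\| \le 1/2$, so it is invertible, and $w_n = A^{-1} b_n$ does the job.

  For the frame inequality, expand $z_n = \sum_k c_{nk} v_k$. Each $v_k$ is used only for $n \le 2k$,
  hence $\|x\| \le \sum_k d_k |v_k^* x|$ with finite $d_k = \sum_{n \le 2k} \|w_n\| |c_{nk}|$, and
  the Cauchy-Schwarz inequality with the weights $2^{-k}$ gives the claim for
  $\lambda_k = 2^k d_k^2 + 1$.
\<close>

section \<open>Inner products\<close>

lemma cinner_add_left: "cinner (x + y) z = cinner x z + cinner y (z::'a::chilbert_space)"
  by (metis cinner_add_right cinner_commute complex_cnj_add)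

lemma cinner_scaleC_left: "cinner (a *\<^sub>C x) y = cnj a * cinner x (y::'a::chilbert_space)"
  by (metis cinner_commute cinner_scaleC_right complex_cnj_mult)

lemma additive_cinner_right: "Modules.additive (cinner (x::'a::chilbert_space))"
  by standard (rule cinner_add_right)

lemma additive_cinner_left: "Modules.additive (\<lambda>x. cinner x (y::'a::chilbert_space))"
  by standard (rule cinner_add_left)

lemmas cinner_zero_right [simp] = additive.zero[OF additive_cinner_right]
  and cinner_zero_left [simp] = additive.zero[OF additive_cinner_left]
  and cinner_diff_right = additive.diff[OF additive_cinner_right]
  and cinner_diff_left = additive.diff[OF additive_cinner_left]
  and cinner_sum_right = additive.sum[OF additive_cinner_right]
  and cinner_sum_left = additive.sum[OF additive_cinner_left]

lemma mult_cnj_eq_power2_cmod: "a * cnj a = (complex_of_real (cmod a))\<^sup>2"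
  by (simp add: complex_norm_square[symmetric])

lemma norm_scaleC: "norm (a *\<^sub>C x) = cmod a * norm (x::'a::chilbert_space)"
proof -
  have "cinner (a *\<^sub>C x) (a *\<^sub>C x) = of_real ((cmod a)\<^sup>2) * cinner x x"
    by (simp add: cinner_scaleC_left cinner_scaleC_right mult_cnj_eq_power2_cmod)
  moreover have "Re (of_real r * c) = r * Re c" for r c by simp
  ultimately have "Re (cinner (a *\<^sub>C x) (a *\<^sub>C x)) = (cmod a)\<^sup>2 * Re (cinner x x)"
    by (simp only:)
  then show ?thesis
    by (simp add: norm_eq_sqrt_cinner[of x] norm_eq_sqrt_cinner[of "a *\<^sub>C x"] real_sqrt_mult)
qed

lemma power2_norm_eq_cinner: "(norm x)\<^sup>2 = Re (cinner x (x::'a::chilbert_space))"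
  by (simp add: norm_eq_sqrt_cinner cinner_ge_zero)

lemma cinner_self: "cinner x x = of_real ((norm (x::'a::chilbert_space))\<^sup>2)"
proof -
  have "Im (cinner x x) = 0"
    using cinner_commute[of x x] by (metis Reals_cnj_iff complex_is_Real_iff)
  then show ?thesis by (simp add: complex_eq_iff power2_norm_eq_cinner)
qed

lemma power2_norm_diff:
  "(norm (x - y))\<^sup>2 = (norm x)\<^sup>2 - 2 * Re (cinner y x) + (norm (y::'a::chilbert_space))\<^sup>2"
proof -
  have "Re (cinner x y) = Re (cinner y x)"
    using cinner_commute[of x y] by (metis complex_cnj(1) cnj.simps(1))
  then show ?thesis
    by (simp add: power2_norm_eq_cinner cinner_diff_left cinner_diff_right)
qed

text \<open>As a function of \<open>c\<close> this is least at
  \<open>c = cinner y x / (norm y)^2\<close>. That choice yields Cauchy-Schwarz below, and later the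
  orthogonality of a nearest-point residual.\<close>

lemma power2_norm_diff_scaleC:
  "(norm (x - c *\<^sub>C y))\<^sup>2 =
     (norm x)\<^sup>2 - 2 * Re (cnj c * cinner y x) + (cmod c * norm (y::'a::chilbert_space))\<^sup>2"
  by (simp add: power2_norm_diff cinner_scaleC_left norm_scaleC)

lemma parallelogram:
  "(norm (x - y))\<^sup>2 + (norm (x + y))\<^sup>2 = 2 * (norm x)\<^sup>2 + 2 * (norm (y::'a::chilbert_space))\<^sup>2"
  by (simp add: power2_norm_eq_cinner cinner_diff_left cinner_diff_right cinner_add_left cinner_add_right)

lemma norm_cinner_le: "cmod (cinner y x) \<le> norm x * norm (y::'a::chilbert_space)"
proof (cases "y = 0")
  case False
  define c where "c = cinner y x / of_real ((norm y)\<^sup>2)"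
  have ny: "(norm y)\<^sup>2 > 0" using False by simp
  have "cnj c * cinner y x = of_real ((cmod (cinner y x))\<^sup>2 / (norm y)\<^sup>2)"
    by (simp add: c_def mult_cnj_eq_power2_cmod mult.commute[of _ a] mult.commute[of _ "cinner y x"])
  then have 1: "Re (cnj c * cinner y x) = (cmod (cinner y x))\<^sup>2 / (norm y)\<^sup>2" by (simp only: Re_complex_of_real)
  have 2: "(cmod c * norm y)\<^sup>2 = (cmod (cinner y x))\<^sup>2 / (norm y)\<^sup>2"
    using ny by (simp add: c_def norm_divide norm_mult norm_power power2_eq_square field_simps)
  have "0 \<le> (norm (x - c *\<^sub>C y))\<^sup>2" by simp
  then have "(cmod (cinner y x))\<^sup>2 / (norm y)\<^sup>2 \<le> (norm x)\<^sup>2"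
    unfolding power2_norm_diff_scaleC 1 2 by simp
  then have "(cmod (cinner y x))\<^sup>2 \<le> (norm x * norm y)\<^sup>2"
    using ny by (simp add: divide_le_eq power_mult_distrib)
  then show ?thesis
    by (rule power2_le_imp_le) simp
qed simp

lemma bounded_linear_scaleC: "bounded_linear (\<lambda>x::'a::chilbert_space. a *\<^sub>C x)"
  by (rule bounded_linear_intro[where K="cmod a"])
     (simp_all add: scaleC_add_right scaleR_scaleC scaleC_scaleC norm_scaleC mult_ac)

lemma bounded_linear_cinner_right: "bounded_linear (cinner (y::'a::chilbert_space))"
  by (rule bounded_linear_intro[where K="norm y"])
     (simp_all add: cinner_add_right scaleR_scaleC cinner_scaleC_right norm_cinner_le scaleC_complex_def)

text \<open>The kernel of \<open>cinner x\<close> is a subspace, and closed by continuity. Applied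
  with \<open>y = x\<close>, this shows that a vector of a closed span orthogonal to its generators
  is zero.\<close>

lemma cinner_cspan_eq_0:
  assumes "\<And>y. y \<in> S \<Longrightarrow> cinner x y = 0" "y \<in> closure (cspan S)"
  shows "cinner x (y::'a::chilbert_space) = 0"
proof -
  have "cinner x y = 0" if "y \<in> cspan S" for y
    using that
    by (induction rule: complex_vector.span_induct_alt)
       (auto simp: cinner_add_right cinner_scaleC_right assms(1))
  moreover have "closed {y. cinner x y = 0}"
    by (intro closed_Collect_eq continuous_intros bounded_linear.continuous_on[OF bounded_linear_cinner_right])
  ultimately have "closure (cspan S) \<subseteq> {y. cinner x y = 0}"
    by (intro closure_minimal) auto
  then show ?thesis using assms(2) by auto
qed

lemma cinner_eq_0_commute: "cinner x y = 0 \<longleftrightarrow> cinner y (x::'a::chilbert_space) = 0"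
  by (metis cinner_commute complex_cnj_zero_iff)

section \<open>Closed subspaces\<close>

abbreviation csubspace :: "'a::chilbert_space set \<Rightarrow> bool"
  where "csubspace \<equiv> complex_vector.subspace"

lemma csubspace_closure:
  assumes "csubspace (S::'a::chilbert_space set)"
  shows "csubspace (closure S)"
proof (rule complex_vector.subspaceI)
  show "0 \<in> closure S"
    using assms complex_vector.subspace_0 closure_subset by blast
next
  fix x y assume "x \<in> closure S" "y \<in> closure S"
  then obtain f g where "\<forall>n. f n \<in> S" "f \<longlonglongrightarrow> x" "\<forall>n. g n \<in> S" "g \<longlonglongrightarrow> y"
    unfolding closure_sequential by blast
  then show "x + y \<in> closure S"
    unfolding closure_sequential
    by (intro exI[of _ "\<lambda>n. f n + g n"]) (auto intro: tendsto_add complex_vector.subspace_add[OF assms])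
next
  fix c x assume "x \<in> closure S"
  then obtain f where "\<forall>n. f n \<in> S" "f \<longlonglongrightarrow> x"
    unfolding closure_sequential by blast
  then show "c *\<^sub>C x \<in> closure S"
    unfolding closure_sequential
    by (intro exI[of _ "\<lambda>n. c *\<^sub>C f n"])
       (auto intro: bounded_linear.tendsto[OF bounded_linear_scaleC] complex_vector.subspace_scale[OF assms])
qed

lemma csubspace_closure_cspan: "csubspace (closure (cspan S))"
  by (simp add: csubspace_closure)

lemma closure_cspan_minimal:
  assumes "S \<subseteq> M" "csubspace M" "closed M"
  shows "closure (cspan S) \<subseteq> M"
  by (simp add: assms closure_minimal complex_vector.span_minimal)

lemma closure_cspan_mono: "S \<subseteq> T \<Longrightarrow> closure (cspan S) \<subseteq> closure (cspan T)"
  by (simp add: closure_mono complex_vector.span_mono)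

lemma closure_cspan_base: "x \<in> S \<Longrightarrow> x \<in> closure (cspan S)"
  using closure_subset complex_vector.span_base by blast

text \<open>By the parallelogram law a minimising sequence in \<open>M\<close> is Cauchy, because
  midpoints stay in \<open>M\<close>. Completeness gives a limit, which lies in the closed set
  \<open>M\<close>.\<close>

lemma closest_point_exists:
  fixes x :: "'a::chilbert_space"
  assumes M: "csubspace M" "closed M"
  shows "\<exists>p\<in>M. \<forall>y\<in>M. norm (x - p) \<le> norm (x - y)"
proof -
  define d where "d = infdist x M"
  have ne: "M \<noteq> {}" using complex_vector.subspace_0[OF M(1)] by auto
  have d_le: "d \<le> norm (x - y)" if "y \<in> M" for y
    unfolding d_def dist_norm[symmetric] using that by (rule infdist_le)
  have d0: "0 \<le> d" unfolding d_def by (rule infdist_nonneg)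
  have "\<exists>y\<in>M. norm (x - y) < d + 1 / real (Suc n)" for n
  proof -
    have "(INF y\<in>M. dist x y) < d + 1 / real (Suc n)"
      using ne by (simp add: d_def infdist_def)
    then show ?thesis
      using ne by (subst (asm) cINF_less_iff) (auto simp: dist_norm intro: bdd_belowI2[of _ 0])
  qed
  then obtain y where yM: "\<And>n. y n \<in> M" and y: "\<And>n. norm (x - y n) < d + 1 / real (Suc n)"
    by metis
  have y2: "(norm (x - y n))\<^sup>2 \<le> (d + 1 / real (Suc n))\<^sup>2" for n
    using y[of n] by (intro power_mono) auto
  have dist_y: "(norm (y m - y n))\<^sup>2 \<le> 2 * (d + 1 / real (Suc m))\<^sup>2 + 2 * (d + 1 / real (Suc n))\<^sup>2 - 4 * d\<^sup>2" for m n
  proof -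
    \<comment> \<open>The midpoint is at distance at least \<open>d\<close> from \<open>x\<close>,
      so the two residuals have a sum of norm at least \<open>2 * d\<close>; this bounds their
      difference from above.\<close>
    have mid: "(1/2) *\<^sub>R (y m + y n) \<in> M"
      unfolding scaleR_scaleC using yM M(1) by (intro complex_vector.subspace_scale complex_vector.subspace_add)
    have "(x - y n) + (x - y m) = 2 *\<^sub>R (x - (1/2) *\<^sub>R (y m + y n))"
      by (simp add: algebra_simps scaleR_2)
    then have "norm ((x - y n) + (x - y m)) = 2 * norm (x - (1/2) *\<^sub>R (y m + y n))"
      by simp
    then have "2 * d \<le> norm ((x - y n) + (x - y m))"
      using d_le[OF mid] by simp
    then have "(2 * d)\<^sup>2 \<le> (norm ((x - y n) + (x - y m)))\<^sup>2"
      using d0 by (intro power_mono) auto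
    moreover have "(x - y n) - (x - y m) = y m - y n" by simp
    ultimately show ?thesis
      using parallelogram[of "x - y n" "x - y m"] y2[of m] y2[of n] by simp
  qed
  have "Cauchy y"
  proof (rule metric_CauchyI)
    fix e :: real assume e: "0 < e"
    have "(\<lambda>n. (d + 1 / real (Suc n))\<^sup>2 - d\<^sup>2) \<longlonglongrightarrow> (d + 0)\<^sup>2 - d\<^sup>2"
      by (intro tendsto_intros LIMSEQ_inverse_real_of_nat[unfolded inverse_eq_divide])
    \<comment> \<open>By \<open>dist_y\<close> the squared distance is at most twice the sum of two
      such excesses, hence the quarter of \<open>e^2\<close>.\<close>
    then have "eventually (\<lambda>n. (d + 1 / real (Suc n))\<^sup>2 - d\<^sup>2 < e\<^sup>2 / 4) sequentially"
      using e by (intro order_tendstoD(2)) auto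
    then obtain N where N: "\<And>n. n \<ge> N \<Longrightarrow> (d + 1 / real (Suc n))\<^sup>2 - d\<^sup>2 < e\<^sup>2 / 4"
      unfolding eventually_sequentially by blast
    have "dist (y m) (y n) < e" if "m \<ge> N" "n \<ge> N" for m n
    proof -
      have "(norm (y m - y n))\<^sup>2 < e\<^sup>2"
        using dist_y[of m n] N[OF that(1)] N[OF that(2)] by linarith
      then show ?thesis using e by (simp add: dist_norm power2_less_imp_less)
    qed
    then show "\<exists>N. \<forall>m\<ge>N. \<forall>n\<ge>N. dist (y m) (y n) < e" by blast
  qed
  then obtain p where p: "y \<longlonglongrightarrow> p" using Cauchy_convergent convergent_def by blast
  have "p \<in> M" using closed_sequentially[OF M(2) _ p] yM by simp
  moreover have "norm (x - p) \<le> d"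
  proof (rule LIMSEQ_le)
    show "(\<lambda>n. norm (x - y n)) \<longlonglongrightarrow> norm (x - p)" by (intro tendsto_intros p)
    show "(\<lambda>n. d + 1 / real (Suc n)) \<longlonglongrightarrow> d"
      using tendsto_add[OF tendsto_const LIMSEQ_inverse_real_of_nat[unfolded inverse_eq_divide], of d] by simp
    show "\<exists>N. \<forall>n\<ge>N. norm (x - y n) \<le> d + 1 / real (Suc n)" using y less_imp_le by blast
  qed
  ultimately show ?thesis using d_le by force
qed

lemma orthogonal_projection_exists:
  fixes x :: "'a::chilbert_space"
  assumes M: "csubspace M" "closed M"
  shows "\<exists>p\<in>M. \<forall>y\<in>M. cinner y (x - p) = 0"
proof -
  obtain p where p: "p \<in> M" and min: "\<And>y. y \<in> M \<Longrightarrow> norm (x - p) \<le> norm (x - y)"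
    using closest_point_exists[OF M] by blast
  have "cinner y (x - p) = 0" if y: "y \<in> M" for y
  proof (cases "y = 0")
    case False
    define a where "a = cinner y (x - p)"
    \<comment> \<open>Moving from \<open>p\<close> to \<open>p + c *\<^sub>C y\<close> with this
      optimal \<open>c\<close> lowers the squared distance to \<open>x\<close> by
      \<open>(cmod a)^2 / (norm y)^2\<close>. Minimality of \<open>p\<close> forces
      \<open>a = 0\<close>.\<close>
    define c where "c = a / of_real ((norm y)\<^sup>2)"
    have ny: "(norm y)\<^sup>2 > 0" using False by simp
    have "norm (x - p) \<le> norm (x - (p + c *\<^sub>C y))"
      using p y M(1) by (intro min complex_vector.subspace_add complex_vector.subspace_scale)
    then have "(norm (x - p))\<^sup>2 \<le> (norm ((x - p) - c *\<^sub>C y))\<^sup>2"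
      by (intro power_mono) (simp_all add: algebra_simps)
    then have le: "2 * Re (cnj c * a) \<le> (cmod c * norm y)\<^sup>2"
      unfolding power2_norm_diff_scaleC a_def by simp
    have "cnj c * a = of_real ((cmod a)\<^sup>2 / (norm y)\<^sup>2)"
      by (simp add: c_def mult_cnj_eq_power2_cmod mult.commute[of _ a] mult.commute[of _ "cinner y x"])
    then have 1: "Re (cnj c * a) = (cmod a)\<^sup>2 / (norm y)\<^sup>2" by (simp only: Re_complex_of_real)
    have 2: "(cmod c * norm y)\<^sup>2 = (cmod a)\<^sup>2 / (norm y)\<^sup>2"
      using ny by (simp add: c_def norm_divide norm_mult norm_power power2_eq_square field_simps)
    have "(cmod a)\<^sup>2 / (norm y)\<^sup>2 \<le> 0" using le unfolding 1 2 by simp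
    then have "(cmod a)\<^sup>2 \<le> 0" using ny by (simp add: divide_le_0_iff)
    then show ?thesis by (simp add: a_def)
  qed simp
  then show ?thesis using p by blast
qed

text \<open>Here \<open>e\<close> is the normalised residual of \<open>u\<close> modulo
  \<open>M\<close>, or zero if \<open>u\<close> lies in \<open>M\<close>. The formula for
  \<open>u\<close> transfers orthogonality from \<open>M\<close> and \<open>e\<close> to
  \<open>u\<close>; the formula for \<open>e\<close> keeps it in every subspace containing
  \<open>M\<close> and \<open>u\<close>.\<close>

lemma gram_schmidt_step:
  fixes u :: "'a::chilbert_space"
  assumes M: "csubspace M" "closed M"
  shows "\<exists>e. (e = 0 \<or> norm e = 1) \<and> (\<forall>y\<in>M. cinner y e = 0) \<and>
             (\<exists>p\<in>M. \<exists>c d. u = p + c *\<^sub>C e \<and> e = d *\<^sub>C (u - p))"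
proof -
  obtain p where p: "p \<in> M" "\<And>y. y \<in> M \<Longrightarrow> cinner y (u - p) = 0"
    using orthogonal_projection_exists[OF M] by blast
  show ?thesis
  proof (cases "u = p")
    case True
    then show ?thesis using p(1)
      by (intro exI[of _ 0]) auto
  next
    case False
    define r where "r = complex_of_real (norm (u - p))"
    have r: "r \<noteq> 0" using False by (simp add: r_def)
    define e where "e = inverse r *\<^sub>C (u - p)"
    have "norm e = 1" using False by (simp add: e_def r_def norm_scaleC norm_inverse)
    moreover have "cinner y e = 0" if "y \<in> M" for y
      using p(2)[OF that] by (simp add: e_def cinner_scaleC_right)
    moreover have "u = p + r *\<^sub>C e" using r by (simp add: e_def scaleC_scaleC scaleC_one)
    ultimately show ?thesis using p(1) e_def by blast
  qed
qed

section \<open>Orthonormal expansions\<close>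

text \<open>Zero vectors are allowed, so that a basis can be indexed by all positive integers even when
  the space is finite-dimensional.\<close>

definition orthonormal_or_zero :: "(nat \<Rightarrow> 'a::chilbert_space) \<Rightarrow> bool"
  where "orthonormal_or_zero b \<longleftrightarrow>
    (\<forall>n\<ge>1. b n = 0 \<or> norm (b n) = 1) \<and> (\<forall>m\<ge>1. \<forall>n\<ge>1. m \<noteq> n \<longrightarrow> cinner (b m) (b n) = 0)"

lemma cinner_orthonormal_sum:
  assumes b: "orthonormal_or_zero b" and "finite F" "\<And>i. i \<in> F \<Longrightarrow> 1 \<le> i" "1 \<le> n"
  shows "cinner (b n) (\<Sum>i\<in>F. cinner (b i) x *\<^sub>C b i) = (if n \<in> F then cinner (b n) x else 0)"
proof -
  have "cinner (b n) (cinner (b i) x *\<^sub>C b i) = (if i = n then cinner (b n) x else 0)" if "i \<in> F" for i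
  proof (cases "i = n")
    case True
    \<comment> \<open>If \<open>b n = 0\<close>, both sides vanish; otherwise the norm of
      \<open>b n\<close> is 1.\<close>
    then show ?thesis
      using b assms(4) by (auto simp: orthonormal_or_zero_def cinner_scaleC_right cinner_self)
  next
    case False
    then show ?thesis
      using b assms(3)[OF that] assms(4) by (simp add: orthonormal_or_zero_def cinner_scaleC_right)
  qed
  then have "cinner (b n) (\<Sum>i\<in>F. cinner (b i) x *\<^sub>C b i) = (\<Sum>i\<in>F. if i = n then cinner (b n) x else 0)"
    by (simp add: cinner_sum_right)
  then show ?thesis using assms(2) by simp
qed

lemma norm_orthonormal_sum:
  assumes b: "orthonormal_or_zero b" and F: "finite F" "\<And>i. i \<in> F \<Longrightarrow> 1 \<le> i"
  shows "(norm (\<Sum>i\<in>F. cinner (b i) x *\<^sub>C b i))\<^sup>2 = (\<Sum>i\<in>F. (cmod (cinner (b i) x))\<^sup>2)"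
    and "cinner (\<Sum>i\<in>F. cinner (b i) x *\<^sub>C b i) x = of_real (\<Sum>i\<in>F. (cmod (cinner (b i) x))\<^sup>2)"
proof -
  have "cinner (\<Sum>i\<in>F. cinner (b i) x *\<^sub>C b i) (\<Sum>i\<in>F. cinner (b i) x *\<^sub>C b i)
      = (\<Sum>i\<in>F. of_real ((cmod (cinner (b i) x))\<^sup>2))"
    unfolding cinner_sum_left
    by (rule sum.cong)
       (use F in \<open>simp_all add: cinner_scaleC_left cinner_orthonormal_sum[OF b] complex_norm_square mult_ac
          del: of_real_power\<close>)
  then show "(norm (\<Sum>i\<in>F. cinner (b i) x *\<^sub>C b i))\<^sup>2 = (\<Sum>i\<in>F. (cmod (cinner (b i) x))\<^sup>2)"
    by (simp only: power2_norm_eq_cinner of_real_sum[symmetric] Re_complex_of_real)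
  show "cinner (\<Sum>i\<in>F. cinner (b i) x *\<^sub>C b i) x = of_real (\<Sum>i\<in>F. (cmod (cinner (b i) x))\<^sup>2)"
    by (simp add: cinner_sum_left cinner_scaleC_left complex_norm_square mult_ac del: of_real_power)
qed

lemma bessel:
  assumes b: "orthonormal_or_zero b" and F: "finite F" "\<And>i. i \<in> F \<Longrightarrow> 1 \<le> i"
  shows "(\<Sum>i\<in>F. (cmod (cinner (b i) x))\<^sup>2) \<le> (norm x)\<^sup>2"
proof -
  define q where "q = (\<Sum>i\<in>F. (cmod (cinner (b i) x))\<^sup>2)"
  have "0 \<le> (norm (x - (\<Sum>i\<in>F. cinner (b i) x *\<^sub>C b i)))\<^sup>2" by simp
  also have "\<dots> = (norm x)\<^sup>2 - 2 * Re (of_real q) + q"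
    unfolding power2_norm_diff q_def by (simp only: norm_orthonormal_sum[OF b F])
  finally show ?thesis by (simp add: q_def)
qed

text \<open>Bessel's inequality makes the partial sums Cauchy. Their limit has the same coefficients
  as \<open>x\<close>, so the difference is orthogonal to every \<open>b n\<close> and vanishes by
  totality.\<close>

lemma orthonormal_expansion:
  fixes x :: "'a::chilbert_space"
  assumes b: "orthonormal_or_zero b"
    and total: "\<And>x. (\<And>n. 1 \<le> n \<Longrightarrow> cinner (b n) x = 0) \<Longrightarrow> x = 0"
  shows "(\<lambda>N. \<Sum>n=1..N. cinner (b n) x *\<^sub>C b n) \<longlonglongrightarrow> x"
proof -
  define S where "S N = (\<Sum>n=1..N. cinner (b n) x *\<^sub>C b n)" for N
  define q where "q N = (\<Sum>n=1..N. (cmod (cinner (b n) x))\<^sup>2)" for N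
  have "mono q"
    unfolding q_def by (intro monoI sum_mono2) auto
  moreover have "bdd_above (range q)"
    unfolding q_def by (intro bdd_aboveI2[where M="(norm x)\<^sup>2"] bessel[OF b]) auto
  ultimately have "Cauchy q"
    by (metis LIMSEQ_incseq_SUP LIMSEQ_imp_Cauchy)
  have step: "(norm (S n - S m))\<^sup>2 = q n - q m" if "m \<le> n" for m n
  proof -
    have I: "{1..n} = {1..m} \<union> {m<..n}" using that by auto
    have "S n - S m = (\<Sum>i\<in>{m<..n}. cinner (b i) x *\<^sub>C b i)"
      unfolding S_def I by (subst sum.union_disjoint) auto
    moreover have "q n - q m = (\<Sum>i\<in>{m<..n}. (cmod (cinner (b i) x))\<^sup>2)"
      unfolding q_def I by (subst sum.union_disjoint) auto
    ultimately show ?thesis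
      using norm_orthonormal_sum(1)[OF b, of "{m<..n}" x] by auto
  qed
  have "Cauchy S"
  proof (rule metric_CauchyI)
    fix e :: real assume e: "0 < e"
    then obtain N where N: "\<And>m n. m \<ge> N \<Longrightarrow> n \<ge> N \<Longrightarrow> norm (q m - q n) < e\<^sup>2"
      using CauchyD[OF \<open>Cauchy q\<close>, of "e\<^sup>2"] by auto
    have *: "dist (S m) (S n) < e" if "m \<ge> N" "n \<ge> m" for m n
    proof -
      have "(norm (S n - S m))\<^sup>2 < e\<^sup>2"
        using N[of n m] that step[of m n] by auto
      then show ?thesis using e by (simp add: dist_norm norm_minus_commute power2_less_imp_less)
    qed
    then have "dist (S m) (S n) < e" if "m \<ge> N" "n \<ge> N" for m n
      using that by (metis dist_commute linorder_le_cases)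
    then show "\<exists>M. \<forall>m\<ge>M. \<forall>n\<ge>M. dist (S m) (S n) < e" by blast
  qed
  then obtain s where s: "S \<longlonglongrightarrow> s" using Cauchy_convergent convergent_def by blast
  have "x - s = 0"
  proof (rule total)
    fix n :: nat assume n: "1 \<le> n"
    have "(\<lambda>N. cinner (b n) (S N)) \<longlonglongrightarrow> cinner (b n) s"
      by (rule bounded_linear.tendsto[OF bounded_linear_cinner_right s])
    \<comment> \<open>From \<open>N = n\<close> on, the \<open>n\<close>-th coefficient of the
      partial sum no longer changes.\<close>
    moreover have "eventually (\<lambda>N. cinner (b n) (S N) = cinner (b n) x) sequentially"
      using eventually_ge_at_top[of n]
    proof eventually_elim
      case (elim N)
      then show ?case
        using cinner_orthonormal_sum[OF b, of "{1..N}" n x] n by (auto simp: S_def)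
    qed
    ultimately have "cinner (b n) s = cinner (b n) x"
      by (rule LIMSEQ_unique[OF _ tendsto_eventually])
    then show "cinner (b n) (x - s) = 0" by (simp add: cinner_diff_right)
  qed
  then show ?thesis using s unfolding S_def by simp
qed

section \<open>A basis adapted to the tail spaces\<close>

lemma adapted_basis_exists:
  fixes v :: "nat \<Rightarrow> 'a::chilbert_space"
  assumes v: "total_sequence v"
  shows "\<exists>b. orthonormal_or_zero b \<and>
     (\<forall>x. (\<forall>n\<ge>1. cinner (b n) x = 0) \<longrightarrow> x = 0) \<and>
     (\<forall>n\<ge>1. b n \<in> closure (cspan {v k | k. 1 \<le> k \<and> real n / 2 \<le> real k}))"
proof -
  define V where "V m = closure (cspan {v k | k. m \<le> k})" for m
  have V: "csubspace (V m)" "closed (V m)" for m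
    unfolding V_def by (auto intro: csubspace_closure_cspan)
  have V_anti: "V n \<subseteq> V m" if "m \<le> n" for m n
    unfolding V_def using that by (intro closure_cspan_mono) auto
  \<comment> \<open>Index 0 is left out, since \<open>v 0\<close> is not part of the given
    sequence.\<close>
  define L where "L = (\<Inter>m\<in>{1..}. V m)"
  have L: "csubspace L" "closed L"
    unfolding L_def using V by (auto intro: complex_vector.subspace_Inter)
  have L_sub: "L \<subseteq> V m" if "1 \<le> m" for m unfolding L_def using that by auto

  have "\<exists>f. \<forall>m. (f m = 0 \<or> norm (f m) = 1) \<and> (\<forall>y\<in>V (Suc m). cinner y (f m) = 0) \<and>
      (\<exists>p\<in>V (Suc m). \<exists>c d. v m = p + c *\<^sub>C f m \<and> f m = d *\<^sub>C (v m - p))"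
    by (intro choice allI gram_schmidt_step V)
  then obtain f where f: "\<And>m. f m = 0 \<or> norm (f m) = 1" "\<And>m y. y \<in> V (Suc m) \<Longrightarrow> cinner y (f m) = 0"
      "\<And>m. \<exists>p\<in>V (Suc m). \<exists>c d. v m = p + c *\<^sub>C f m \<and> f m = d *\<^sub>C (v m - p)"
    by blast
  have fV: "f m \<in> V m" for m
  proof -
    obtain p d where p: "p \<in> V (Suc m)" "f m = d *\<^sub>C (v m - p)" using f(3) by blast
    then have "p \<in> V m" using V_anti[of m "Suc m"] by auto
    moreover have "v m \<in> V m" unfolding V_def by (rule closure_cspan_base) auto
    ultimately show ?thesis
      unfolding p(2) using V(1) by (intro complex_vector.subspace_scale complex_vector.subspace_diff)
  qed

  \<comment> \<open>The projections of the \<open>v k\<close> to \<open>L\<close> have dense span in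
    \<open>L\<close>, so Gram-Schmidt applied to them produces the basis \<open>g\<close> of
    \<open>L\<close>. The shift by \<open>Suc\<close> makes \<open>u\<close> start at index
    0.\<close>
  have "\<exists>u. \<forall>n. u n \<in> L \<and> (\<forall>y\<in>L. cinner y (v (Suc n) - u n) = 0)"
    using orthogonal_projection_exists[OF L] by (intro choice) blast
  then obtain u where u: "\<And>n. u n \<in> L" "\<And>n y. y \<in> L \<Longrightarrow> cinner y (v (Suc n) - u n) = 0"
    by blast
  define W where "W n = closure (cspan {u k | k. k < n})" for n
  have W: "csubspace (W n)" "closed (W n)" for n
    unfolding W_def by (auto intro: csubspace_closure_cspan)
  have W_mono: "W m \<subseteq> W n" if "m \<le> n" for m n
    unfolding W_def using that by (intro closure_cspan_mono) auto
  have W_sub: "W n \<subseteq> L" for n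
    unfolding W_def using u(1) L by (intro closure_cspan_minimal) auto
  have "\<exists>g. \<forall>n. (g n = 0 \<or> norm (g n) = 1) \<and> (\<forall>y\<in>W n. cinner y (g n) = 0) \<and>
      (\<exists>p\<in>W n. \<exists>c d. u n = p + c *\<^sub>C g n \<and> g n = d *\<^sub>C (u n - p))"
    by (intro choice allI gram_schmidt_step W)
  then obtain g where g: "\<And>n. g n = 0 \<or> norm (g n) = 1" "\<And>n y. y \<in> W n \<Longrightarrow> cinner y (g n) = 0"
      "\<And>n. \<exists>p\<in>W n. \<exists>c d. u n = p + c *\<^sub>C g n \<and> g n = d *\<^sub>C (u n - p)"
    by blast
  have gW: "g n \<in> W (Suc n)" for n
  proof -
    obtain p d where p: "p \<in> W n" "g n = d *\<^sub>C (u n - p)" using g(3) by blast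
    then have "p \<in> W (Suc n)" using W_mono[of n "Suc n"] by auto
    moreover have "u n \<in> W (Suc n)" unfolding W_def by (rule closure_cspan_base) auto
    ultimately show ?thesis
      unfolding p(2) using W(1) by (intro complex_vector.subspace_scale complex_vector.subspace_diff)
  qed
  have gL: "g n \<in> L" for n using gW W_sub by auto

  have ff: "cinner (f m) (f n) = 0" if "m \<noteq> n" for m n
  proof -
    \<comment> \<open>Gram-Schmidt runs backwards here: the later \<open>f n\<close> lies in
      \<open>V (Suc m)\<close>, to which \<open>f m\<close> is orthogonal.\<close>
    have "cinner (f n) (f m) = 0" if "m < n" for m n
      using f(2) fV[of n] V_anti[of "Suc m" n] that by auto
    then show ?thesis using that cinner_eq_0_commute by (metis nat_neq_iff)
  qed
  have gg: "cinner (g m) (g n) = 0" if "m \<noteq> n" for m n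
  proof -
    have "cinner (g m) (g n) = 0" if "m < n" for m n
      using g(2) gW[of m] W_mono[of "Suc m" n] that by auto
    then show ?thesis using that cinner_eq_0_commute by (metis nat_neq_iff)
  qed
  have gf: "cinner (g n) (f m) = 0" for m n
    using gL L_sub[of "Suc m"] f(2) by auto
  have fg: "cinner (f m) (g n) = 0" for m n
    using gf cinner_eq_0_commute by blast

  \<comment> \<open>Position \<open>2 * m - 1\<close> carries \<open>f m\<close> for
    \<open>m \<ge> 1\<close>, and position \<open>2 * m + 2\<close> carries \<open>g m\<close> for
    \<open>m \<ge> 0\<close>. Since \<open>f m\<close> is only known to lie in \<open>V m\<close>,
    interlacing costs the factor 2 in the tail condition; each \<open>g m\<close> lies in all these
    tails.\<close>
  define b where "b n = (if odd n then f ((n + 1) div 2) else g (n div 2 - 1))" for n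
  have "orthonormal_or_zero b"
    unfolding orthonormal_or_zero_def
  proof (intro conjI allI impI)
    fix n show "b n = 0 \<or> norm (b n) = 1" using f(1) g(1) by (simp add: b_def)
  next
    fix m n :: nat assume mn: "1 \<le> m" "1 \<le> n" "m \<noteq> n"
    have "(m + 1) div 2 \<noteq> (n + 1) div 2" if "odd m" "odd n"
      using that mn by (auto elim!: oddE)
    moreover have "m div 2 - 1 \<noteq> n div 2 - 1" if "even m" "even n"
      using that mn by (auto elim!: evenE)
    ultimately show "cinner (b m) (b n) = 0" using ff gg fg gf by (auto simp: b_def)
  qed
  moreover have "x = 0" if orth: "\<forall>n\<ge>1. cinner (b n) x = 0" for x
  proof -
    have xf: "cinner (f m) x = 0" if "1 \<le> m" for m
      using orth[rule_format, of "2 * m - 1"] that by (simp add: b_def)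
    have xg: "cinner x (g m) = 0" for m
      using orth[rule_format, of "2 * Suc m"] cinner_eq_0_commute by (auto simp: b_def)
    \<comment> \<open>Being orthogonal to all \<open>f m\<close>, the vector \<open>x\<close>
      descends through the tail spaces one at a time, starting from \<open>V 1\<close>, which is the
      whole space.\<close>
    have "x \<in> V m" if "1 \<le> m" for m
      using that
    proof (induction m rule: nat_induct_at_least)
      case base
      then show ?case using v unfolding V_def total_sequence_def by simp
    next
      case (Suc m)
      \<comment> \<open>The residual \<open>x - p\<close> is orthogonal to \<open>V (Suc m)\<close>
        and to \<open>f m\<close>, hence to every generator of \<open>V m\<close>. It also lies in
        \<open>V m\<close>, so it is zero.\<close>
      obtain p where p: "p \<in> V (Suc m)" "\<And>y. y \<in> V (Suc m) \<Longrightarrow> cinner y (x - p) = 0"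
        using orthogonal_projection_exists[OF V] by blast
      have fm: "cinner (f m) (x - p) = 0"
        using xf[OF Suc.hyps] f(2)[OF p(1)] cinner_eq_0_commute by (auto simp: cinner_diff_right)
      have vm: "cinner (v m) (x - p) = 0"
      proof -
        obtain r c where "r \<in> V (Suc m)" "v m = r + c *\<^sub>C f m" using f(3) by blast
        then show ?thesis using fm p(2) by (simp add: cinner_add_left cinner_scaleC_left)
      qed
      have vk: "cinner (v k) (x - p) = 0" if "Suc m \<le> k" for k
        by (rule p(2), unfold V_def, rule closure_cspan_base) (use that in blast)
      have "cinner (x - p) y = 0" if y: "y \<in> {v k | k. m \<le> k}" for y
      proof -
        obtain k where k: "y = v k" "m \<le> k" using y by blast
        then have "k = m \<or> Suc m \<le> k" by auto
        then have "cinner y (x - p) = 0" using vm vk k(1) by auto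
        then show ?thesis by (simp add: cinner_eq_0_commute)
      qed
      moreover have "x - p \<in> V m"
        using Suc.IH p(1) V_anti[of m "Suc m"] V(1) by (intro complex_vector.subspace_diff) auto
      ultimately have "cinner (x - p) (x - p) = 0"
        unfolding V_def by (rule cinner_cspan_eq_0)
      then show ?case using p(1) by (simp add: cinner_eq_zero_iff)
    qed
    then have xL: "x \<in> L" unfolding L_def by auto
    \<comment> \<open>Each \<open>u n\<close> is a combination of \<open>g n\<close> and a limit of
      combinations of earlier \<open>u k\<close>.\<close>
    have xu: "cinner x (u n) = 0" for n
    proof (induction n rule: less_induct)
      case (less n)
      obtain p c where p: "p \<in> W n" "u n = p + c *\<^sub>C g n" using g(3) by blast
      have "cinner x p = 0"
        by (rule cinner_cspan_eq_0[OF _ p(1)[unfolded W_def]]) (use less in auto)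
      then show ?case by (simp add: p(2) cinner_add_right cinner_scaleC_right xg)
    qed
    \<comment> \<open>On \<open>x\<close>, which lies in \<open>L\<close>, the vector
      \<open>v n\<close> acts like its projection \<open>u (n - 1)\<close>.\<close>
    have "cinner x (v n) = 0" if "1 \<le> n" for n
      using u(2)[OF xL, of "n - 1"] xu[of "n - 1"] that by (simp add: cinner_diff_right)
    then have "cinner x y = 0" if "y \<in> {v n | n. 1 \<le> n}" for y
      using that by blast
    moreover have "x \<in> closure (cspan {v n | n. 1 \<le> n})"
      using v by (simp add: total_sequence_def)
    ultimately have "cinner x x = 0" by (rule cinner_cspan_eq_0)
    then show "x = 0" by (simp add: cinner_eq_zero_iff)
  qed
  moreover have "b n \<in> closure (cspan {v k | k. 1 \<le> k \<and> real n / 2 \<le> real k})" if "1 \<le> n" for n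
  proof -
    define m where "m = (n + 1) div 2"
    have m: "1 \<le> m" using that by (simp add: m_def)
    have "b n \<in> V m" using fV subsetD[OF L_sub[OF m] gL] by (auto simp: b_def m_def)
    also have "V m \<subseteq> closure (cspan {v k | k. 1 \<le> k \<and> real n / 2 \<le> real k})"
      unfolding V_def
    proof (intro closure_cspan_mono subsetI)
      fix y assume "y \<in> {v k | k. m \<le> k}"
      then obtain k where k: "y = v k" "m \<le> k" by blast
      then have "n \<le> 2 * k" by (simp add: m_def)
      then have "real n / 2 \<le> real k" by linarith
      then show "y \<in> {v k | k. 1 \<le> k \<and> real n / 2 \<le> real k}" using k m by auto
    qed
    finally show ?thesis .
  qed
  ultimately show ?thesis by blast
qed

section \<open>Perturbation of the basis\<close>

lemma perturbed_expansion:
  fixes b z :: "nat \<Rightarrow> 'a::chilbert_space"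
  assumes b: "orthonormal_or_zero b"
    and total: "\<And>x. (\<And>n. 1 \<le> n \<Longrightarrow> cinner (b n) x = 0) \<Longrightarrow> x = 0"
    and z: "\<And>n. 1 \<le> n \<Longrightarrow> norm (b n - z n) \<le> (1/2) ^ Suc n"
  shows "\<exists>w. sot_sums (\<lambda>n. outer (w n) (z n)) id"
proof -
  \<comment> \<open>The operator \<open>K\<close> is \<open>id - A\<close>. The index shift turns
    the series from 1 into a \<open>suminf\<close> from 0.\<close>
  define t where "t x n = cinner (b (Suc n) - z (Suc n)) x *\<^sub>C b (Suc n)" for x n
  define K where "K x = (\<Sum>n. t x n)" for x
  have nb: "norm (b n) \<le> 1" if "1 \<le> n" for n
    using b that unfolding orthonormal_or_zero_def by fastforce
  have t_le: "norm (t x n) \<le> norm x / 2 * (1/2) ^ Suc n" for x n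
  proof -
    have "norm (t x n) \<le> cmod (cinner (b (Suc n) - z (Suc n)) x) * 1"
      unfolding t_def norm_scaleC by (intro mult_left_mono nb) auto
    also have "\<dots> \<le> norm x * norm (b (Suc n) - z (Suc n))"
      using norm_cinner_le by simp
    also have "\<dots> \<le> norm x * (1/2) ^ Suc (Suc n)"
      by (intro mult_left_mono z) auto
    finally show ?thesis by simp
  qed
  have geo: "(\<lambda>n. norm x / 2 * (1/2) ^ Suc n) sums (norm x / 2)" for x :: 'a
    using sums_mult[OF power_half_series, of "norm x / 2"] by simp
  have t_summable: "summable (t x)" for x
    by (rule summable_comparison_test'[OF sums_summable[OF geo] t_le])
  have K_le: "norm (K x) \<le> norm x / 2" for x
    using norm_suminf_le[OF t_le sums_summable[OF geo], of x]
    unfolding K_def sums_unique[OF geo, symmetric] .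
  have K_diff: "K (x - y) = K x - K y" for x y
  proof -
    have "t (x - y) = (\<lambda>n. t x n - t y n)"
      by (simp add: t_def fun_eq_iff cinner_diff_right complex_vector.scale_left_diff_distrib)
    then show ?thesis unfolding K_def by (simp add: suminf_diff t_summable)
  qed
  define A where "A x = x - K x" for x
  have A_diff: "A (x - y) = A x - A y" for x y by (simp add: A_def K_diff)
  have A_scale: "A (c *\<^sub>C x) = c *\<^sub>C A x" for c x
  proof -
    have "t (c *\<^sub>C x) = (\<lambda>n. c *\<^sub>C t x n)"
      by (simp add: t_def fun_eq_iff cinner_scaleC_right scaleC_scaleC)
    then have "K (c *\<^sub>C x) = c *\<^sub>C K x"
      unfolding K_def by (simp add: bounded_linear.suminf[OF bounded_linear_scaleC t_summable])
    then show ?thesis by (simp add: A_def complex_vector.scale_right_diff_distrib)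
  qed
  have A_add: "A (x + y) = A x + A y" for x y
    using A_diff[of "x + y" y] by (simp add: algebra_simps)
  have A_sum: "A (sum f F) = (\<Sum>i\<in>F. A (f i))" for f :: "nat \<Rightarrow> 'a" and F
    by (rule additive.sum) (standard, rule A_add)
  \<comment> \<open>This lower bound plays the part of continuity of the inverse of
    \<open>A\<close>.\<close>
  have A_ge: "norm x \<le> 2 * norm (A x)" for x
    using norm_triangle_ineq2[of x "K x"] K_le[of x] by (simp add: A_def)
  have "\<exists>x. A x = y" for y
  proof -
    \<comment> \<open>Solving \<open>A x = y\<close> means finding a fixed point of a contraction
      with factor 1/2.\<close>
    have "\<exists>!x. y + K x = x"
    proof (rule banach_fix_type[where c="1/2"])
      show "\<forall>x x'. dist (y + K x) (y + K x') \<le> 1/2 * dist x x'"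
        using K_le by (simp add: dist_norm flip: K_diff)
    qed simp_all
    then show ?thesis by (metis A_def add_diff_cancel_right')
  qed
  then have "\<exists>w. \<forall>n. A (w n) = b n" by (intro choice) blast
  then obtain w where w: "\<And>n. A (w n) = b n" by blast
  have A_series: "(\<lambda>N. \<Sum>n=1..N. cinner (z n) x *\<^sub>C b n) \<longlonglongrightarrow> A x" for x
  proof -
    have "(\<lambda>N. \<Sum>n=1..N. cinner (b n - z n) x *\<^sub>C b n) = (\<lambda>N. \<Sum>n<N. t x n)"
      by (simp add: t_def sum.atLeast1_atMost_eq fun_eq_iff)
    moreover have "(\<lambda>N. \<Sum>n<N. t x n) \<longlonglongrightarrow> K x"
      unfolding K_def by (rule summable_LIMSEQ[OF t_summable])
    ultimately have "(\<lambda>N. \<Sum>n=1..N. cinner (b n - z n) x *\<^sub>C b n) \<longlonglongrightarrow> K x"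
      by simp
    \<comment> \<open>Subtracting the series of \<open>K x\<close> from the orthonormal expansion of
      \<open>x\<close> leaves the coefficients \<open>cinner (z n) x\<close>.\<close>
    from tendsto_diff[OF orthonormal_expansion[OF b total] this, of x]
    show ?thesis
      by (simp add: A_def cinner_diff_left complex_vector.scale_left_diff_distrib flip: sum_subtractf)
  qed
  have "(\<lambda>N. \<Sum>n=1..N. outer (w n) (z n) x) \<longlonglongrightarrow> x" for x
  proof -
    \<comment> \<open>\<open>A\<close> sends the error of the desired series to the error of the
      series for \<open>A x\<close>, and \<open>A_ge\<close> carries the convergence back.\<close>
    have "A ((\<Sum>n=1..N. outer (w n) (z n) x) - x) = (\<Sum>n=1..N. cinner (z n) x *\<^sub>C b n) - A x" for N
      by (simp add: A_diff A_sum A_scale outer_def w)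
    then have le: "norm ((\<Sum>n=1..N. outer (w n) (z n) x) - x)
        \<le> 2 * norm ((\<Sum>n=1..N. cinner (z n) x *\<^sub>C b n) - A x)" for N
      using A_ge by metis
    have "(\<lambda>N. 2 * norm ((\<Sum>n=1..N. cinner (z n) x *\<^sub>C b n) - A x)) \<longlonglongrightarrow> 0"
      using tendsto_mult_right_zero[OF tendsto_norm_zero[OF LIM_zero[OF A_series]]] by blast
    then have "(\<lambda>N. (\<Sum>n=1..N. outer (w n) (z n) x) - x) \<longlonglongrightarrow> 0"
      by (rule Lim_null_comparison[rotated]) (use le in auto)
    then show ?thesis by (rule LIM_zero_cancel)
  qed
  then show ?thesis unfolding sot_sums_def by auto
qed

section \<open>The lower frame inequality\<close>

text \<open>A span element has coefficients attached to vectors. As \<open>v\<close> may repeat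
  values, one index is chosen for each vector that occurs.\<close>

lemma cspan_image_expansion:
  fixes v :: "nat \<Rightarrow> 'a::chilbert_space"
  assumes "z \<in> cspan (v ` I)"
  shows "\<exists>F c. finite F \<and> F \<subseteq> I \<and> z = (\<Sum>k\<in>F. c k *\<^sub>C v k)"
proof -
  obtain t r where t: "finite t" "t \<subseteq> v ` I" "z = (\<Sum>a\<in>t. r a *\<^sub>C a)"
    using assms unfolding complex_vector.span_explicit by blast
  then obtain F where F: "F \<subseteq> I" "inj_on v F" "t = v ` F"
    unfolding subset_image_inj by blast
  then have "finite F" using t(1) finite_image_iff by blast
  have "z = (\<Sum>k\<in>F. r (v k) *\<^sub>C v k)" using t(3) F by (simp add: sum.reindex)
  then show ?thesis using F(1) \<open>finite F\<close> by (intro exI[of _ F] exI[of _ "\<lambda>k. r (v k)"]) simp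
qed

text \<open>Split each term into \<open>2^(-k/2)\<close> times \<open>2^(k/2) * d k * a k\<close>.
  The squares of the first factors sum to less than 1, uniformly in \<open>M\<close>.\<close>

lemma weighted_cauchy_schwarz:
  fixes d a :: "nat \<Rightarrow> real"
  shows "(\<Sum>k=1..M. d k * a k)\<^sup>2 \<le> (\<Sum>k=1..M. (2 ^ k * (d k)\<^sup>2) * (a k)\<^sup>2)"
proof -
  define s where "s k = sqrt (2 ^ k)" for k :: nat
  have s: "s k > 0" "(s k)\<^sup>2 = 2 ^ k" for k by (simp_all add: s_def)
  have "(\<Sum>k=1..M. d k * a k) = (\<Sum>k=1..M. inverse (s k) * (s k * d k * a k))"
    using s(1) by (intro sum.cong) (auto simp: less_imp_neq[symmetric])
  then have "(\<Sum>k=1..M. d k * a k)\<^sup>2 \<le> (\<Sum>k=1..M. (inverse (s k))\<^sup>2) * (\<Sum>k=1..M. (s k * d k * a k)\<^sup>2)"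
    using Cauchy_Schwarz_ineq_sum by simp
  also have "(\<Sum>k=1..M. (s k * d k * a k)\<^sup>2) = (\<Sum>k=1..M. (2 ^ k * (d k)\<^sup>2) * (a k)\<^sup>2)"
    by (simp add: power_mult_distrib s)
  also have "(\<Sum>k=1..M. (inverse (s k))\<^sup>2) = (\<Sum>k=1..M. (1/2) ^ k)"
    by (simp add: power_inverse s power_one_over inverse_eq_divide)
  also have "(\<Sum>k=1..M. (1/2::real) ^ k) = 1 - (1/2) ^ M"
    by (induction M) auto
  also have "(1 - (1/2) ^ M) * (\<Sum>k=1..M. (2 ^ k * (d k)\<^sup>2) * (a k)\<^sup>2)
      \<le> 1 * (\<Sum>k=1..M. (2 ^ k * (d k)\<^sup>2) * (a k)\<^sup>2)"
    by (intro mult_right_mono sum_nonneg) auto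
  finally show ?thesis by simp
qed

lemma lower_frame_inequality:
  fixes v w z :: "nat \<Rightarrow> 'a::chilbert_space"
  assumes z: "\<And>n. 1 \<le> n \<Longrightarrow> z n \<in> cspan {v k | k. 1 \<le> k \<and> real n / 2 \<le> real k}"
    and id: "sot_sums (\<lambda>n. outer (w n) (z n)) id"
  shows "\<exists>lam :: nat \<Rightarrow> real. (\<forall>n\<ge>1. 0 < lam n) \<and>
            (\<forall>x :: 'a. ennreal ((norm x)\<^sup>2)
                 \<le> (\<Sum>n. ennreal (lam (Suc n) * (cmod (cinner (v (Suc n)) x))\<^sup>2)))"
proof -
  have "\<exists>F c. finite F \<and> F \<subseteq> {k. 1 \<le> k \<and> n \<le> 2 * k} \<and> z n = (\<Sum>k\<in>F. c k *\<^sub>C v k)"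
    if "1 \<le> n" for n
  proof (rule cspan_image_expansion)
    have "{v k | k. 1 \<le> k \<and> real n / 2 \<le> real k} = v ` {k. 1 \<le> k \<and> n \<le> 2 * k}"
      by (auto simp: field_simps image_iff)
    then show "z n \<in> cspan (v ` {k. 1 \<le> k \<and> n \<le> 2 * k})" using z[OF that] by simp
  qed
  then obtain F c where F: "\<And>n. 1 \<le> n \<Longrightarrow> finite (F n)"
      "\<And>n. 1 \<le> n \<Longrightarrow> F n \<subseteq> {k. 1 \<le> k \<and> n \<le> 2 * k}"
      "\<And>n. 1 \<le> n \<Longrightarrow> z n = (\<Sum>k\<in>F n. c n k *\<^sub>C v k)"
    by metis
  \<comment> \<open>The weight with which \<open>cmod (cinner (v k) x)\<close> enters the bound for
    the \<open>n\<close>-th term of the series.\<close>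
  define e where "e n k = (if k \<in> F n then norm (w n) * cmod (c n k) else 0)" for n k
  have e0: "0 \<le> e n k" for n k by (simp add: e_def)
  \<comment> \<open>The tail condition on \<open>z n\<close> makes this finite sum collect every
    nonzero \<open>e n k\<close> with \<open>n \<ge> 1\<close>.\<close>
  define d where "d k = (\<Sum>n=1..2*k. e n k)" for k
  \<comment> \<open>The summand 1 keeps the weight positive when \<open>d k = 0\<close>.\<close>
  define lam where "lam k = 2 ^ k * (d k)\<^sup>2 + 1" for k
  have "ennreal ((norm x)\<^sup>2) \<le> (\<Sum>n. ennreal (lam (Suc n) * (cmod (cinner (v (Suc n)) x))\<^sup>2))" for x
  proof -
    define a where "a k = cmod (cinner (v k) x)" for k
    have a0: "0 \<le> a k" for k by (simp add: a_def)
    define S where "S N = (\<Sum>n=1..N. outer (w n) (z n) x)" for N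
    have S: "S \<longlonglongrightarrow> x" using id unfolding sot_sums_def S_def by simp
    \<comment> \<open>The bound is proved for each partial sum with a right-hand side independent of
      \<open>N\<close>, so it survives the limit even if that side is infinite.\<close>
    have "ennreal ((norm (S N))\<^sup>2) \<le> (\<Sum>n. ennreal (lam (Suc n) * (a (Suc n))\<^sup>2))" for N
    proof -
      have "finite (\<Union>n\<in>{1..N}. F n)" using F(1) by auto
      \<comment> \<open>Only finitely many \<open>v k\<close> occur in the first \<open>N\<close>
        terms, so everything reduces to finite sums up to \<open>M\<close>.\<close>
      then obtain M where M: "\<And>n k. n \<in> {1..N} \<Longrightarrow> k \<in> F n \<Longrightarrow> k \<le> M"
        by (metis UN_I finite_nat_set_iff_bounded_le)
      have "norm (outer (w n) (z n) x) \<le> (\<Sum>k=1..M. e n k * a k)" if n: "n \<in> {1..N}" for n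
      proof -
        have n1: "1 \<le> n" using n by simp
        have "norm (outer (w n) (z n) x) = norm (\<Sum>k\<in>F n. cnj (c n k) * cinner (v k) x) * norm (w n)"
          using n1 by (simp add: outer_def norm_scaleC F(3) cinner_sum_left cinner_scaleC_left)
        also have "\<dots> \<le> (\<Sum>k\<in>F n. norm (cnj (c n k) * cinner (v k) x)) * norm (w n)"
          by (intro mult_right_mono norm_sum) auto
        also have "\<dots> = (\<Sum>k\<in>F n. e n k * a k)"
          by (simp add: sum_distrib_left norm_mult a_def e_def mult_ac)
        also have "\<dots> \<le> (\<Sum>k=1..M. e n k * a k)"
          using F(2)[OF n1] M[OF n] e0 a0 by (intro sum_mono2) auto
        finally show ?thesis .
      qed
      then have "norm (S N) \<le> (\<Sum>n=1..N. \<Sum>k=1..M. e n k * a k)"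
        unfolding S_def by (intro sum_norm_le) auto
      also have "\<dots> = (\<Sum>k=1..M. (\<Sum>n=1..N. e n k) * a k)"
        by (subst sum.swap) (simp add: sum_distrib_right)
      also have "\<dots> \<le> (\<Sum>k=1..M. d k * a k)"
      proof (intro sum_mono mult_right_mono a0)
        fix k
        have "(\<Sum>n=1..N. e n k) = (\<Sum>n\<in>{1..N} \<inter> {1..2*k}. e n k)"
        proof (intro sum.mono_neutral_right ballI)
          fix n assume "n \<in> {1..N} - {1..N} \<inter> {1..2*k}"
          then show "e n k = 0" using F(2)[of n] by (auto simp: e_def)
        qed auto
        also have "\<dots> \<le> d k" unfolding d_def using e0 by (intro sum_mono2) auto
        finally show "(\<Sum>n=1..N. e n k) \<le> d k" .
      qed
      finally have "(norm (S N))\<^sup>2 \<le> (\<Sum>k=1..M. d k * a k)\<^sup>2"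
        by (intro power_mono) auto
      also have "\<dots> \<le> (\<Sum>k=1..M. (2 ^ k * (d k)\<^sup>2) * (a k)\<^sup>2)"
        by (rule weighted_cauchy_schwarz)
      also have "\<dots> \<le> (\<Sum>k=1..M. lam k * (a k)\<^sup>2)"
        by (intro sum_mono mult_right_mono) (auto simp: lam_def)
      also have "\<dots> = (\<Sum>n<M. lam (Suc n) * (a (Suc n))\<^sup>2)"
        by (simp add: sum.atLeast1_atMost_eq)
      finally have "ennreal ((norm (S N))\<^sup>2) \<le> ennreal (\<Sum>n<M. lam (Suc n) * (a (Suc n))\<^sup>2)"
        by (rule ennreal_leI)
      also have "\<dots> = (\<Sum>n<M. ennreal (lam (Suc n) * (a (Suc n))\<^sup>2))"
        by (simp add: sum_ennreal lam_def)
      also have "\<dots> \<le> (\<Sum>n. ennreal (lam (Suc n) * (a (Suc n))\<^sup>2))"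
        by (rule sum_le_suminf) auto
      finally show ?thesis .
    qed
    then have le: "ennreal ((norm (S N))\<^sup>2) \<le> (\<Sum>n. ennreal (lam (Suc n) * (cmod (cinner (v (Suc n)) x))\<^sup>2))" for N
      by (simp only: a_def)
    have "(\<lambda>N. ennreal ((norm (S N))\<^sup>2)) \<longlonglongrightarrow> ennreal ((norm x)\<^sup>2)"
      by (intro tendsto_ennrealI tendsto_intros S)
    then show ?thesis by (rule LIMSEQ_le_const2) (use le in blast)
  qed
  moreover have "0 < lam n" for n by (simp add: lam_def add_nonneg_pos)
  ultimately show ?thesis by blast
qed

theorem mainTheorem1:
  fixes v :: "nat \<Rightarrow> 'a::chilbert_space"
  assumes "total_sequence v"
  shows "(\<exists>w z :: nat \<Rightarrow> 'a.
            (\<forall>n\<ge>1. z n \<in> cspan {v k | k. 1 \<le> k \<and> real n / 2 \<le> real k}) \<and>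
            sot_sums (\<lambda>n. outer (w n) (z n)) id) \<and>
         (\<exists>lam :: nat \<Rightarrow> real.
            (\<forall>n\<ge>1. 0 < lam n) \<and>
            (\<forall>x :: 'a. ennreal ((norm x)\<^sup>2)
                 \<le> (\<Sum>n. ennreal (lam (Suc n) * (cmod (cinner (v (Suc n)) x))\<^sup>2))))"
proof -
  obtain b where b: "orthonormal_or_zero b"
      "\<And>x. (\<And>n. 1 \<le> n \<Longrightarrow> cinner (b n) x = 0) \<Longrightarrow> x = 0"
      "\<And>n. 1 \<le> n \<Longrightarrow> b n \<in> closure (cspan {v k | k. 1 \<le> k \<and> real n / 2 \<le> real k})"
    using adapted_basis_exists[OF assms] by blast
  \<comment> \<open>Passing from the closure to the algebraic span costs an error at each
    \<open>n\<close>; these tolerances sum to 1/2 over \<open>n \<ge> 1\<close>.\<close>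
  have "\<exists>y\<in>cspan {v k | k. 1 \<le> k \<and> real n / 2 \<le> real k}. norm (b n - y) \<le> (1/2) ^ Suc n"
    if n: "1 \<le> n" for n
  proof -
    have "0 < (1/2 :: real) ^ Suc n" by simp
    then obtain y where "y \<in> cspan {v k | k. 1 \<le> k \<and> real n / 2 \<le> real k}" "dist y (b n) < (1/2) ^ Suc n"
      using b(3)[OF n] unfolding closure_approachable by blast
    then show ?thesis by (intro bexI[of _ y]) (simp_all add: dist_norm norm_minus_commute)
  qed
  then have "\<exists>z. \<forall>n\<in>{1..}. z n \<in> cspan {v k | k. 1 \<le> k \<and> real n / 2 \<le> real k} \<and>
      norm (b n - z n) \<le> (1/2) ^ Suc n"
    by (intro bchoice) blast
  then obtain z where z: "\<And>n. 1 \<le> n \<Longrightarrow> z n \<in> cspan {v k | k. 1 \<le> k \<and> real n / 2 \<le> real k}"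
      "\<And>n. 1 \<le> n \<Longrightarrow> norm (b n - z n) \<le> (1/2) ^ Suc n"
    by (meson atLeast_iff)
  obtain w where w: "sot_sums (\<lambda>n. outer (w n) (z n)) id"
    using perturbed_expansion[OF b(1,2) z(2)] by blast
  show ?thesis
    by (rule conjI, rule exI[of _ w], rule exI[of _ z], use z(1) w in blast)
       (rule lower_frame_inequality[OF z(1) w])
qed

end
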